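(* Suppose Alice is given a matroid $\mathcal{M}_1=(U,\mathcal{I}_1)$ and Bob is given a matroid $\mathcal{M}_2=(U,\mathcal{I}_2)$ on a common ground set $U$ with $|U|=n$. Any deterministic communication protocol between Alice and Bob that solves the matroid intersection problem (finding a maximum-size set in $\mathcal{I}_1\cap\mathcal{I}_2$) requires $\Omega(n\log n)$ bits of communication. *)

theory Defs
  imports Complex_Main
begin

locale matroid =
  fixes U :: "'a set" and indep :: "'a set set"
  assumes finite_ground: "finite U"
    and indep_subset: "indep \<subseteq> Pow U"
    and empty_indep: "{} \<in> indep"
    and hereditary: "\<lbrakk>Y \<in> indep; X \<subseteq> Y\<rbrakk> \<Longrightarrow> X \<in> indep"
    and augmentation:
      "\<lbrakk>X \<in> indep; Y \<in> indep; card X < card Y\<rbrakk> \<Longrightarrow> \<exists>e \<in> Y - X. insert e X \<in> indep"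

text \<open>
  Deterministic two-party protocols as binary trees, following Yao: at each inner node the
  player who owns it sends one bit, an arbitrary function of that player's own input (and, via the
  position of the node in the tree, of the bits exchanged so far).  A leaf carries the output, which
  is hence determined by the transcript and known to both players.
\<close>

datatype ('x, 'y, 'z) protocol =
    Output 'z
  | Alice "'x \<Rightarrow> bool" "('x, 'y, 'z) protocol" "('x, 'y, 'z) protocol"
  | Bob "'y \<Rightarrow> bool" "('x, 'y, 'z) protocol" "('x, 'y, 'z) protocol"

primrec outcome :: "('x, 'y, 'z) protocol \<Rightarrow> 'x \<Rightarrow> 'y \<Rightarrow> 'z" where
  "outcome (Output z) x y = z"
| "outcome (Alice f P Q) x y = (if f x then outcome P x y else outcome Q x y)"
| "outcome (Bob g P Q) x y = (if g y then outcome P x y else outcome Q x y)"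

primrec bits :: "('x, 'y, 'z) protocol \<Rightarrow> 'x \<Rightarrow> 'y \<Rightarrow> nat" where
  "bits (Output z) x y = 0"
| "bits (Alice f P Q) x y = Suc (if f x then bits P x y else bits Q x y)"
| "bits (Bob g P Q) x y = Suc (if g y then bits P x y else bits Q x y)"

text \<open>
  The ground set is known to both players, so the input of a player is just the family of
  independent sets of that player's matroid.
\<close>

type_synonym 'a matroid_protocol = "('a set set, 'a set set, 'a set) protocol"

definition solves_matroid_intersection :: "'a set \<Rightarrow> 'a matroid_protocol \<Rightarrow> bool" where
  "solves_matroid_intersection U P \<longleftrightarrow>
     (\<forall>I1 I2. matroid U I1 \<and> matroid U I2 \<longrightarrow>
        is_arg_max card (\<lambda>S. S \<in> I1 \<inter> I2) (outcome P I1 I2))"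

text \<open>
  Worst case over pairs of matroids on \<open>U\<close> only.  For finite \<open>U\<close> the maximum
  ranges over a finite nonempty set; it is at most the height of the protocol tree.
\<close>

definition communication_cost :: "'a set \<Rightarrow> 'a matroid_protocol \<Rightarrow> nat" where
  "communication_cost U P = Max {bits P I1 I2 | I1 I2. matroid U I1 \<and> matroid U I2}"

end

theory Submission
  imports Defs "HOL-Library.Disjoint_Sets" "HOL-Library.Function_Algebras"
begin

text \<open>
  Let Alice and Bob hold partitions \<open>P\<close> and \<open>Q\<close> of a set \<open>V\<close> with two marked points
  \<open>s\<close> and \<open>t\<close>.  On two copies of \<open>V\<close> they form partition matroids whose capacities are the
  block sizes, except that Bob moves one unit of capacity from the block of \<open>s\<close> to that of
  \<open>t\<close>.  A common independent set of size \<open>card V\<close> is a unit flow from \<open>s\<close> to \<open>t\<close>, so it exists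
  iff the join of \<open>P\<close> and \<open>Q\<close> connects \<open>s\<close> with \<open>t\<close>, and the protocol decides this.  Hence the
  0/1 matrix of disconnection has rank at most \<open>2\<^sup>d\<close>, where \<open>d\<close> is the communication cost.

  On partitions separating \<open>s\<close> from \<open>t\<close> this matrix is nonsingular: Moebius inversion factors
  it as \<open>\<zeta> D \<zeta>\<^sup>T\<close>, where \<open>\<zeta>\<close> is the refinement order and the diagonal entries
  \<open>(-1)\<^sup>b (b - 2)!\<close> of \<open>D\<close> do not vanish.  There are at least \<open>k\<^sup>k\<close> such partitions
  with \<open>k\<close> about \<open>n/4\<close>, so \<open>d \<ge> k log k\<close>.
\<close>

subsection \<open>The join of two partitions\<close>

lemma partition_on_block_unique:
  assumes "partition_on A P" "B \<in> P" "C \<in> P" "x \<in> B" "x \<in> C"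
  shows "B = C"
  using assms by (auto simp: partition_on_def disjoint_def)

definition same_block :: "'a set set \<Rightarrow> 'a rel" where
  "same_block P = {(x, y). \<exists>B\<in>P. x \<in> B \<and> y \<in> B}"

lemma equiv_same_block: "partition_on A P \<Longrightarrow> equiv A (same_block P)"
  unfolding same_block_def by (rule equiv_partition_on)

lemma same_block_quotient:
  assumes "equiv A r"
  shows "same_block (A // r) = r"
proof -
  have "(x, y) \<in> same_block (A // r) \<longleftrightarrow> (\<exists>z\<in>A. (z, x) \<in> r \<and> (z, y) \<in> r)" for x y
    by (auto simp: same_block_def quotient_def)
  moreover have "(\<exists>z\<in>A. (z, x) \<in> r \<and> (z, y) \<in> r) \<longleftrightarrow> (x, y) \<in> r" for x y
    using assms by (auto elim!: equivE dest: symD transD refl_onD)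
  ultimately show ?thesis
    by auto
qed

lemma same_block_cong:
  assumes "partition_on A P" "B \<in> P" "(x, y) \<in> same_block P"
  shows "x \<in> B \<longleftrightarrow> y \<in> B"
  using assms partition_on_block_unique[OF assms(1)] by (auto simp: same_block_def)

lemma refines_imp_partition_on: "refines A P Q \<Longrightarrow> partition_on A Q"
  by (simp add: refines_def)

lemma refines_iff_same_block_subset:
  assumes P: "partition_on A P" and Q: "partition_on A Q"
  shows "refines A P Q \<longleftrightarrow> same_block P \<subseteq> same_block Q"
proof
  assume "refines A P Q"
  then show "same_block P \<subseteq> same_block Q"
    unfolding refines_def same_block_def by blast
next
  assume sub: "same_block P \<subseteq> same_block Q"
  have "\<exists>C\<in>Q. B \<subseteq> C" if "B \<in> P" for B
  proof -
    obtain x where "x \<in> B"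
      using \<open>B \<in> P\<close> partition_onD3[OF P] by (metis ex_in_conv)
    then obtain C where "C \<in> Q" "x \<in> C"
      using \<open>B \<in> P\<close> partition_onD1[OF P] partition_onD1[OF Q] by blast
    moreover have "(x, y) \<in> same_block Q" if "y \<in> B" for y
      using sub \<open>B \<in> P\<close> \<open>x \<in> B\<close> that by (auto simp: same_block_def)
    ultimately show ?thesis
      using same_block_cong[OF Q] by blast
  qed
  then show "refines A P Q"
    using P Q by (simp add: refines_def)
qed

definition join_rel :: "'a set set \<Rightarrow> 'a set set \<Rightarrow> 'a rel" where
  "join_rel P Q = (same_block P \<union> same_block Q)\<^sup>+"

definition partition_join :: "'a set \<Rightarrow> 'a set set \<Rightarrow> 'a set set \<Rightarrow> 'a set set" where
  "partition_join A P Q = A // join_rel P Q"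

lemma same_block_Un_subset_join_rel: "same_block P \<union> same_block Q \<subseteq> join_rel P Q"
  by (auto simp: join_rel_def)

lemma equiv_join_rel:
  assumes "partition_on A P" "partition_on A Q"
  shows "equiv A (join_rel P Q)"
proof (rule equivI)
  have equivs: "equiv A (same_block P)" "equiv A (same_block Q)"
    using assms by (simp_all add: equiv_same_block)
  then show "join_rel P Q \<subseteq> A \<times> A"
    unfolding join_rel_def by (intro trancl_subset_Sigma) (auto elim: equivE)
  show "refl_on A (join_rel P Q)"
    using equivs same_block_Un_subset_join_rel[of P Q] by (auto simp: refl_on_def elim!: equivE)
  show "sym (join_rel P Q)"
    unfolding join_rel_def using equivs by (intro sym_trancl sym_Un) (auto elim: equivE)
  show "trans (join_rel P Q)"
    by (simp add: join_rel_def)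
qed

lemma partition_on_partition_join:
  "partition_on A P \<Longrightarrow> partition_on A Q \<Longrightarrow> partition_on A (partition_join A P Q)"
  unfolding partition_join_def by (intro partition_on_quotient equiv_join_rel)

lemma same_block_partition_join:
  "partition_on A P \<Longrightarrow> partition_on A Q \<Longrightarrow> same_block (partition_join A P Q) = join_rel P Q"
  unfolding partition_join_def by (intro same_block_quotient equiv_join_rel)

lemma refines_partition_join_iff:
  assumes "partition_on A P" "partition_on A Q" "partition_on A Z"
  shows "refines A (partition_join A P Q) Z \<longleftrightarrow> refines A P Z \<and> refines A Q Z"
proof -
  have "trans (same_block Z)"
    using equiv_same_block[OF assms(3)] by (auto elim: equivE)
  then have "join_rel P Q \<subseteq> same_block Z \<longleftrightarrow> same_block P \<union> same_block Q \<subseteq> same_block Z"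
    using trancl_mono_subset[of "same_block P \<union> same_block Q" "same_block Z"]
      same_block_Un_subset_join_rel[of P Q] by (auto simp: join_rel_def trancl_id)
  then show ?thesis
    using assms by (simp add: refines_iff_same_block_subset partition_on_partition_join
        same_block_partition_join)
qed

subsection \<open>Moebius inversion over separating partitions\<close>

text \<open>The choice \<open>C = {}\<close> makes \<open>B\<close> a block of its own.\<close>

definition merge_block :: "'a set \<Rightarrow> 'a set set \<times> 'a set \<Rightarrow> 'a set set" where
  "merge_block B = (\<lambda>(Z, C). insert (B \<union> C) (Z - {C}))"

lemma refines_merge_block:
  assumes "refines A J Z" "C \<in> insert {} Z" "B \<noteq> {}" "B \<inter> A = {}"
  shows "refines (B \<union> A) (insert B J) (merge_block B (Z, C))"
proof -
  have J: "partition_on A J" and Z: "partition_on A Z"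
    using assms(1) by (auto simp: refines_def)
  have "partition_on (B \<union> A) (insert B J)"
    using J assms(3,4)
    by (subst partition_on_insert) (auto simp: disjnt_def Un_Diff Diff_triv partition_on_def)
  moreover have "partition_on (B \<union> A) (merge_block B (Z, C))"
  proof (rule partition_onI)
    show "\<Union>(merge_block B (Z, C)) = B \<union> A"
      using assms(2) partition_onD1[OF Z] by (auto simp: merge_block_def)
    show "{} \<notin> merge_block B (Z, C)"
      using assms(3) partition_onD3[OF Z] by (simp add: merge_block_def)
    show "disjnt D E" if "D \<in> merge_block B (Z, C)" "E \<in> merge_block B (Z, C)" "D \<noteq> E" for D E
      using that assms(2,4) partition_onD1[OF Z] partition_on_block_unique[OF Z]
      by (auto simp: merge_block_def disjnt_iff)
  qed
  moreover have "\<exists>Y\<in>merge_block B (Z, C). X \<subseteq> Y" if X: "X \<in> insert B J" for X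
  proof (cases "X = B")
    case False
    then obtain E where "E \<in> Z" "X \<subseteq> E"
      using X assms(1) unfolding refines_def by blast
    then show ?thesis
      by (cases "E = C") (auto simp: merge_block_def)
  qed (auto simp: merge_block_def)
  ultimately show ?thesis
    by (simp add: refines_def)
qed

lemma inj_on_merge_block:
  assumes "B \<noteq> {}" "B \<inter> A = {}"
  shows "inj_on (merge_block B) (SIGMA Z:{Z. partition_on A Z}. insert {} Z)"
proof (rule inj_onI, clarify)
  fix Z C Z' C'
  assume Z: "partition_on A Z" "C \<in> insert {} Z" and Z': "partition_on A Z'" "C' \<in> insert {} Z'"
    and eq: "merge_block B (Z, C) = merge_block B (Z', C')"
  have subA: "D \<subseteq> A" if "D \<in> insert {} Z \<union> insert {} Z'" for D
    using that partition_onD1[OF Z(1)] partition_onD1[OF Z'(1)] by auto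
  then have new: "B \<union> D \<notin> Z" "B \<union> D \<notin> Z'" for D
    using assms by blast+
  have "B \<union> C \<in> merge_block B (Z', C')"
    unfolding eq[symmetric] by (simp add: merge_block_def)
  then have "B \<union> C = B \<union> C'"
    using new by (simp add: merge_block_def)
  then have "C = C'"
    using subA[of C] subA[of C'] Z(2) Z'(2) assms(2) by blast
  moreover have "Z - {C} = Z' - {C'}"
    using eq new unfolding \<open>C = C'\<close> by (simp add: merge_block_def insert_ident)
  moreover have "{} \<notin> Z" "{} \<notin> Z'"
    using partition_onD3 Z(1) Z'(1) by auto
  ultimately show "Z = Z' \<and> C = C'"
    using Z(2) Z'(2) by blast
qed

lemma partition_on_shrink_block:
  assumes Y: "partition_on (B \<union> A) Y" and D: "D \<in> Y" "B \<subseteq> D" and "B \<inter> A = {}"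
  shows "partition_on A (Y - {D} \<union> ({D - B} - {{}}))"
proof -
  define C where "C = D - B"
  have "D = B \<union> C" "C \<subseteq> A"
    using D partition_onD1[OF Y] by (auto simp: C_def)
  have "E \<inter> D = {}" if "E \<in> Y - {D}" for E
    using that D(1) partition_on_block_unique[OF Y] by blast
  then have disj: "disjnt D (\<Union>(Y - {D}))"
    by (auto simp: disjnt_def)
  then have "partition_on (B \<union> A - D) (Y - {D})"
    using Y D(1) partition_on_insert[of D "Y - {D}" "B \<union> A"] by (simp add: insert_absorb)
  moreover have "B \<union> A - D = A - C"
    using assms(4) \<open>D = B \<union> C\<close> by auto
  moreover have "disjnt C (\<Union>(Y - {D}))"
    using disj by (simp add: \<open>D = B \<union> C\<close> disjnt_Un1)
  ultimately have "partition_on A (Y - {D} \<union> ({C} - {{}}))"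
    using \<open>C \<subseteq> A\<close> partition_on_insert[of C "Y - {D}" A] by (cases "C = {}") simp_all
  then show ?thesis
    by (simp add: C_def)
qed

lemma merge_block_shrink_block:
  assumes Y: "partition_on A Y" and D: "D \<in> Y" "B \<subseteq> D"
  shows "merge_block B (Y - {D} \<union> ({D - B} - {{}}), D - B) = Y"
proof -
  have "{} \<notin> Y"
    using partition_onD3[OF Y] .
  then have "D - B = D" if "D - B \<in> Y"
    using partition_on_block_unique[OF Y that D(1)] that by (metis Diff_iff ex_in_conv)
  moreover have "B \<union> (D - B) = D"
    using D(2) by blast
  ultimately show ?thesis
    using D(1) \<open>{} \<notin> Y\<close> by (auto simp: merge_block_def)
qed

lemma refines_insert_imp_merge_block:
  assumes Y: "refines (B \<union> A) (insert B J) Y" and J: "partition_on A J"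
    and B: "B \<noteq> {}" "B \<inter> A = {}"
  shows "\<exists>Z C. refines A J Z \<and> C \<in> insert {} Z \<and> Y = merge_block B (Z, C)"
proof -
  have partY: "partition_on (B \<union> A) Y"
    using Y by (rule refines_imp_partition_on)
  have coarser: "\<exists>E\<in>Y. X \<subseteq> E" if "X \<in> insert B J" for X
    using Y that unfolding refines_def by (elim conjE) (rule bspec)
  then obtain D where D: "D \<in> Y" "B \<subseteq> D"
    by (meson insertI1)
  let ?Z = "Y - {D} \<union> ({D - B} - {{}})"
  have "\<exists>E\<in>?Z. X \<subseteq> E" if X: "X \<in> J" for X
  proof -
    obtain E where E: "E \<in> Y" "X \<subseteq> E"
      using X coarser by (meson insertI2)
    have "X \<subseteq> A" "X \<noteq> {}"
      using X partition_onD1[OF J] partition_onD3[OF J] by auto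
    then have "X \<subseteq> D - B \<and> D - B \<noteq> {}" if "E = D"
      using that E(2) B(2) by auto
    then show ?thesis
      using E by (cases "E = D") auto
  qed
  then have "refines A J ?Z"
    using J partition_on_shrink_block[OF partY D B(2)] by (simp add: refines_def)
  moreover have "D - B \<in> insert {} ?Z"
    by auto
  ultimately show ?thesis
    using merge_block_shrink_block[OF partY D] by metis
qed

lemma bij_betw_merge_block:
  assumes J: "partition_on A J" and B: "B \<noteq> {}" "B \<inter> A = {}"
  shows "bij_betw (merge_block B) (SIGMA Z:{Z. refines A J Z}. insert {} Z)
           {Z. refines (B \<union> A) (insert B J) Z}"
  unfolding bij_betw_def
proof
  show "inj_on (merge_block B) (SIGMA Z:{Z. refines A J Z}. insert {} Z)"
    using inj_on_merge_block[OF B] by (rule inj_on_subset) (auto simp: refines_def)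
  show "merge_block B ` (SIGMA Z:{Z. refines A J Z}. insert {} Z)
      = {Z. refines (B \<union> A) (insert B J) Z}"
    using refines_merge_block[OF _ _ B] refines_insert_imp_merge_block[OF _ J B]
    by (fastforce simp: image_iff)
qed

lemma card_merge_block:
  assumes "finite Z" "partition_on A Z" "C \<in> insert {} Z" "B \<noteq> {}" "B \<inter> A = {}"
  shows "card (merge_block B (Z, C)) = (if C = {} then Suc (card Z) else card Z)"
proof -
  have "B \<union> C \<notin> Z"
    using assms(4,5) partition_onD1[OF assms(2)] by blast
  then have "card (merge_block B (Z, C)) = Suc (card (Z - {C}))"
    using assms(1) by (simp add: merge_block_def)
  moreover have "{} \<notin> Z"
    using partition_onD3[OF assms(2)] .
  ultimately show ?thesis
    using assms(1,3) by (auto simp: card_Suc_Diff1 simp del: card_Diff_insert)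
qed

lemma same_block_merge_block_iff:
  assumes "C \<in> insert {} Z" "s \<notin> B" "t \<notin> B"
  shows "(s, t) \<in> same_block (merge_block B (Z, C)) \<longleftrightarrow> (s, t) \<in> same_block Z"
  using assms by (auto simp: same_block_def merge_block_def)

lemma card_ge_2_if_not_same_block:
  assumes "finite Z" "partition_on A Z" "s \<in> A" "t \<in> A" "(s, t) \<notin> same_block Z"
  shows "2 \<le> card Z"
proof -
  obtain B C where BC: "B \<in> Z" "s \<in> B" "C \<in> Z" "t \<in> C"
    using assms(3,4) partition_onD1[OF assms(2)] by blast
  then have "B \<noteq> C"
    using assms(5) by (auto simp: same_block_def)
  then have "card {B, C} = 2"
    by simp
  then show ?thesis
    using BC assms(1) card_mono[of Z "{B, C}"] by simp
qed

text \<open>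
  This is the falling factorial \<open>(-1)(-2)\<dots>(-(b-2))\<close> for \<open>b = card Z\<close>.  It comes from colouring the
  \<open>m\<close> blocks of a partition with \<open>q\<close> colours and two further ones assigned to the blocks of \<open>s\<close> and
  \<open>t\<close>: group the \<open>(q + 2)\<^bsup>m - 2\<^esup>\<close> colourings by their kernel \<open>Z\<close> and put \<open>q = -1\<close>.
\<close>

definition separation_weight :: "'a set set \<Rightarrow> real" where
  "separation_weight Z = (- 1) ^ card Z * fact (card Z - 2)"

lemma separation_weight_nonzero: "separation_weight Z \<noteq> 0"
  by (simp add: separation_weight_def)

lemma sum_separation_weight_merge_block:
  assumes "finite Z" "partition_on A Z" "2 \<le> card Z" "B \<noteq> {}" "B \<inter> A = {}"
  shows "(\<Sum>C\<in>insert {} Z. separation_weight (merge_block B (Z, C))) = separation_weight Z"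
proof -
  obtain k where k: "card Z = Suc (Suc k)"
    using assms(3) by (metis add_2_eq_Suc le_Suc_ex)
  have "{} \<notin> Z"
    using partition_onD3[OF assms(2)] .
  moreover have weight: "separation_weight (merge_block B (Z, C)) =
      (if C = {} then (- 1) ^ Suc (card Z) * fact (card Z - 1) else separation_weight Z)"
    if "C \<in> insert {} Z" for C
    using card_merge_block[OF assms(1,2) that assms(4,5)] by (simp add: separation_weight_def)
  ultimately have "(\<Sum>C\<in>Z. separation_weight (merge_block B (Z, C))) = (\<Sum>C\<in>Z. separation_weight Z)"
    by (intro sum.cong) auto
  then have "(\<Sum>C\<in>insert {} Z. separation_weight (merge_block B (Z, C)))
      = (- 1) ^ Suc (card Z) * fact (card Z - 1) + (\<Sum>C\<in>Z. separation_weight Z)"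
    using assms(1) \<open>{} \<notin> Z\<close> weight[of "{}"] by simp
  also have "\<dots> = separation_weight Z"
    by (simp add: separation_weight_def k algebra_simps)
  finally show ?thesis .
qed

definition separating_coarsenings :: "'a set \<Rightarrow> 'a set set \<Rightarrow> 'a \<Rightarrow> 'a \<Rightarrow> 'a set set set" where
  "separating_coarsenings A J s t = {Z. refines A J Z \<and> (s, t) \<notin> same_block Z}"

lemma separating_coarsenings_two_blocks:
  assumes part: "partition_on A {S, T}" and st: "S \<noteq> T" "s \<in> S" "t \<in> T"
  shows "separating_coarsenings A {S, T} s t = {{S, T}}"
proof -
  have "Z = {S, T}" if Z: "refines A {S, T} Z" "(s, t) \<notin> same_block Z" for Z
  proof -
    have partZ: "partition_on A Z"
      using Z(1) by (simp add: refines_def)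
    then have sub: "same_block {S, T} \<subseteq> same_block Z"
      using Z(1) part by (simp add: refines_iff_same_block_subset)
    have "(x, y) \<in> same_block {S, T}" if xy: "(x, y) \<in> same_block Z" for x y
    proof (rule ccontr)
      assume "(x, y) \<notin> same_block {S, T}"
      moreover have "x \<in> S \<union> T" "y \<in> S \<union> T"
        using xy partition_onD1[OF part] partition_onD1[OF partZ] by (auto simp: same_block_def)
      ultimately have "(s, x) \<in> same_block Z \<and> (y, t) \<in> same_block Z \<or>
          (s, y) \<in> same_block Z \<and> (x, t) \<in> same_block Z"
        using sub st by (auto simp: same_block_def)
      then show False
        using Z(2) xy equiv_same_block[OF partZ] by (meson equivE symD transD)
    qed
    then have "refines A Z {S, T}"
      using part partZ by (auto simp: refines_iff_same_block_subset)
    then show ?thesis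
      using Z(1) by (rule refines_asym)
  qed
  moreover have "(s, t) \<notin> same_block {S, T}"
    using st partition_on_block_unique[OF part, of S T] by (auto simp: same_block_def)
  ultimately show ?thesis
    using refines_refl[OF part] by (auto simp: separating_coarsenings_def)
qed

lemma bij_betw_merge_block_separating_coarsenings:
  assumes J: "partition_on A J" and B: "B \<noteq> {}" "B \<inter> A = {}" and st: "s \<in> A" "t \<in> A"
  shows "bij_betw (merge_block B) (SIGMA Z:separating_coarsenings A J s t. insert {} Z)
           (separating_coarsenings (B \<union> A) (insert B J) s t)"
proof -
  have "bij_betw (merge_block B)
      {p \<in> SIGMA Z:{Z. refines A J Z}. insert {} Z. (s, t) \<notin> same_block (fst p)}
      {Z \<in> {Z. refines (B \<union> A) (insert B J) Z}. (s, t) \<notin> same_block Z}"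
  proof (rule bij_betw_Collect[OF bij_betw_merge_block[OF J B]])
    fix p assume "p \<in> (SIGMA Z:{Z. refines A J Z}. insert {} Z)"
    moreover have "s \<notin> B" "t \<notin> B"
      using st B(2) by auto
    ultimately show "(s, t) \<notin> same_block (merge_block B p) \<longleftrightarrow> (s, t) \<notin> same_block (fst p)"
      using same_block_merge_block_iff[of "snd p" "fst p" s B t] by (cases p) auto
  qed
  moreover have "{p \<in> SIGMA Z:{Z. refines A J Z}. insert {} Z. (s, t) \<notin> same_block (fst p)}
      = (SIGMA Z:separating_coarsenings A J s t. insert {} Z)"
    by (auto simp: separating_coarsenings_def)
  ultimately show ?thesis
    by (simp add: separating_coarsenings_def)
qed

lemma sum_separation_weight_insert:
  assumes A: "finite A" "s \<in> A" "t \<in> A" and J: "partition_on A J"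
    and B: "B \<noteq> {}" "B \<inter> A = {}"
  shows "(\<Sum>Z\<in>separating_coarsenings (B \<union> A) (insert B J) s t. separation_weight Z)
    = (\<Sum>Z\<in>separating_coarsenings A J s t. separation_weight Z)"
proof -
  let ?S = "separating_coarsenings A J s t"
  have part: "partition_on A Z" "(s, t) \<notin> same_block Z" if "Z \<in> ?S" for Z
    using that by (simp_all add: separating_coarsenings_def refines_def)
  then have fin: "finite ?S" "\<And>Z. Z \<in> ?S \<Longrightarrow> finite Z"
    using finite_subset[OF _ finitely_many_partition_on[OF A(1)], of ?S] finite_elements[OF A(1)]
    by auto
  have "(\<Sum>Z\<in>separating_coarsenings (B \<union> A) (insert B J) s t. separation_weight Z)
      = (\<Sum>p\<in>(SIGMA Z:?S. insert {} Z). separation_weight (merge_block B p))"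
    using bij_betw_merge_block_separating_coarsenings[OF J B A(2,3)]
    by (rule sum.reindex_bij_betw[symmetric])
  also have "\<dots> = (\<Sum>Z\<in>?S. \<Sum>C\<in>insert {} Z. separation_weight (merge_block B (Z, C)))"
    using fin by (subst sum.Sigma) (auto simp: case_prod_unfold)
  also have "\<dots> = (\<Sum>Z\<in>?S. separation_weight Z)"
  proof (rule sum.cong[OF refl])
    fix Z assume "Z \<in> ?S"
    then show "(\<Sum>C\<in>insert {} Z. separation_weight (merge_block B (Z, C))) = separation_weight Z"
      using fin(2) part card_ge_2_if_not_same_block[OF _ _ A(2,3)] B
      by (intro sum_separation_weight_merge_block) auto
  qed
  finally show ?thesis .
qed

lemma sum_separation_weight_Un_two_blocks:
  assumes "finite F" "finite A" "partition_on A (F \<union> {S, T})" "S \<notin> F" "T \<notin> F"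
    and st: "S \<noteq> T" "s \<in> S" "t \<in> T"
  shows "(\<Sum>Z\<in>separating_coarsenings A (F \<union> {S, T}) s t. separation_weight Z) = 1"
  using assms(1-5)
proof (induction F arbitrary: A rule: finite_induct)
  case empty
  then show ?case
    using separating_coarsenings_two_blocks[OF _ st] st(1) by (simp add: separation_weight_def)
next
  case (insert B F)
  let ?J = "F \<union> {S, T}"
  have part: "partition_on A (insert B ?J)"
    using insert.prems(2) by (simp only: Un_insert_left)
  moreover have "B \<notin> ?J"
    using insert.hyps(2) insert.prems(3,4) by auto
  ultimately have "disjnt B (\<Union>?J)"
    using partition_onD2[OF part] by (auto simp: pairwise_insert)
  then have B: "partition_on (A - B) ?J" "B \<subseteq> A" "B \<noteq> {}"
    using part by (auto simp only: partition_on_insert)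
  then have "s \<in> A - B" "t \<in> A - B" "B \<union> (A - B) = A"
    using st(2,3) partition_onD1[OF B(1)] by auto
  then show ?case
    using sum_separation_weight_insert[OF _ _ _ B(1,3), of s t] insert.IH[OF _ B(1)] insert.prems
    by (simp only: Un_insert_left finite_Diff) simp
qed

lemma sum_separation_weight:
  assumes A: "finite A" "s \<in> A" "t \<in> A" and J: "partition_on A J" and "(s, t) \<notin> same_block J"
  shows "(\<Sum>Z\<in>separating_coarsenings A J s t. separation_weight Z) = 1"
proof -
  obtain S T where ST: "S \<in> J" "s \<in> S" "T \<in> J" "t \<in> T"
    using A(2,3) partition_onD1[OF J] by blast
  then have "S \<noteq> T" "J - {S, T} \<union> {S, T} = J"
    using assms(5) by (auto simp: same_block_def)
  then show ?thesis
    using sum_separation_weight_Un_two_blocks[of "J - {S, T}" A S T s t] A(1) J ST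
      finite_elements[OF A(1) J] by simp
qed

definition separating_partitions :: "'a set \<Rightarrow> 'a \<Rightarrow> 'a \<Rightarrow> 'a set set set" where
  "separating_partitions A s t = {Z. partition_on A Z \<and> (s, t) \<notin> same_block Z}"

lemma finite_separating_partitions: "finite A \<Longrightarrow> finite (separating_partitions A s t)"
  by (simp add: separating_partitions_def finitely_many_partition_on)

lemma separation_eq_sum_separation_weight:
  assumes A: "finite A" "s \<in> A" "t \<in> A" and P: "partition_on A P" and Q: "partition_on A Q"
  shows "of_bool ((s, t) \<notin> join_rel P Q) =
    (\<Sum>Z | Z \<in> separating_partitions A s t \<and> refines A P Z \<and> refines A Q Z. separation_weight Z)"
proof -
  let ?J = "partition_join A P Q"
  have J: "partition_on A ?J" "same_block ?J = join_rel P Q"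
    using P Q by (simp_all add: partition_on_partition_join same_block_partition_join)
  have coarsenings: "{Z \<in> separating_partitions A s t. refines A P Z \<and> refines A Q Z}
      = separating_coarsenings A ?J s t"
    using refines_partition_join_iff[OF P Q]
    by (auto simp: separating_partitions_def separating_coarsenings_def
        dest: refines_imp_partition_on)
  show ?thesis
  proof (cases "(s, t) \<in> join_rel P Q")
    case True
    then have "(s, t) \<in> same_block Z" if "refines A ?J Z" for Z
      using that J refines_iff_same_block_subset[OF J(1)] refines_def by blast
    then show ?thesis
      using True by (simp add: coarsenings separating_coarsenings_def cong: conj_cong)
  next
    case False
    then show ?thesis
      using sum_separation_weight[OF A J(1)] by (simp add: J(2) coarsenings)
  qed
qed

subsection \<open>Nonsingularity of matrices indexed by a finite poset\<close>

lemma upper_sums_eq_0_imp_eq_0: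
  fixes g :: "'p \<Rightarrow> 'k::comm_monoid_add"
  assumes "finite S" and le: "reflp_on S le" "antisymp_on S le" "transp_on S le"
    and sums: "\<And>x. x \<in> S \<Longrightarrow> (\<Sum>z | z \<in> S \<and> le x z. g z) = 0"
    and "x \<in> S"
  shows "g x = 0"
proof (rule ccontr)
  assume "g x \<noteq> 0"
  let ?less = "\<lambda>x y. le x y \<and> x \<noteq> y"
  have "asymp_on S ?less" "transp_on S ?less"
    using le(2,3) by (auto intro!: asymp_onI transp_onI dest: antisymp_onD transp_onD)
  then obtain m where m: "m \<in> S" "g m \<noteq> 0" "\<forall>y\<in>S. ?less m y \<longrightarrow> \<not> g y \<noteq> 0"
    using Finite_Set.bex_max_element_with_property[OF \<open>finite S\<close>, of ?less "\<lambda>x. g x \<noteq> 0"]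
      \<open>g x \<noteq> 0\<close> \<open>x \<in> S\<close> by blast
  have "(\<Sum>z | z \<in> S \<and> le m z. g z) = (\<Sum>z\<in>{m}. g z)"
    using m \<open>finite S\<close> le(1) by (intro sum.mono_neutral_right) (auto dest: reflp_onD)
  then show False
    using sums[OF m(1)] m(2) by simp
qed

lemma lower_sums_eq_0_imp_eq_0:
  fixes g :: "'p \<Rightarrow> 'k::comm_monoid_add"
  assumes "finite S" "reflp_on S le" "antisymp_on S le" "transp_on S le"
    and "\<And>x. x \<in> S \<Longrightarrow> (\<Sum>z | z \<in> S \<and> le z x. g z) = 0"
    and "x \<in> S"
  shows "g x = 0"
  using upper_sums_eq_0_imp_eq_0[of S "le\<inverse>\<inverse>" g x] assms
  by (simp add: reflp_on_def)

text \<open>The form is \<open>\<zeta> D \<zeta>\<^sup>T\<close> with \<open>\<zeta>\<close> the order and \<open>D\<close> the diagonal matrix of \<open>w\<close>.\<close>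

lemma weighted_upper_bound_sums_nonsingular:
  fixes w c :: "'p \<Rightarrow> 'k::idom"
  assumes "finite S" and le: "reflp_on S le" "antisymp_on S le" "transp_on S le"
    and w: "\<And>z. z \<in> S \<Longrightarrow> w z \<noteq> 0"
    and rel: "\<And>y. y \<in> S \<Longrightarrow> (\<Sum>x\<in>S. c x * (\<Sum>z | z \<in> S \<and> le y z \<and> le x z. w z)) = 0"
    and "x \<in> S"
  shows "c x = 0"
proof -
  have "(\<Sum>z | z \<in> S \<and> le y z. w z * (\<Sum>x | x \<in> S \<and> le x z. c x)) = 0" if "y \<in> S" for y
  proof -
    have "(\<Sum>x\<in>S. c x * (\<Sum>z | z \<in> S \<and> le y z \<and> le x z. w z))
        = (\<Sum>x\<in>S. \<Sum>z | z \<in> {z \<in> S. le y z} \<and> le x z. c x * w z)"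
      by (simp add: sum_distrib_left conj_ac)
    also have "\<dots> = (\<Sum>z | z \<in> S \<and> le y z. \<Sum>x | x \<in> S \<and> le x z. c x * w z)"
      using \<open>finite S\<close> by (subst sum.swap_restrict) auto
    also have "\<dots> = (\<Sum>z | z \<in> S \<and> le y z. w z * (\<Sum>x | x \<in> S \<and> le x z. c x))"
      by (simp add: sum_distrib_left mult.commute)
    finally show ?thesis
      using rel[OF that] by simp
  qed
  then have "w z * (\<Sum>x | x \<in> S \<and> le x z. c x) = 0" if "z \<in> S" for z
    using that by (rule upper_sums_eq_0_imp_eq_0[OF \<open>finite S\<close> le])
  then have "(\<Sum>x | x \<in> S \<and> le x z. c x) = 0" if "z \<in> S" for z
    using that w by simp
  then show ?thesis
    using \<open>x \<in> S\<close> by (rule lower_sums_eq_0_imp_eq_0[OF \<open>finite S\<close> le])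
qed

subsection \<open>The rank bound for protocols\<close>

context vector_space
begin

lemma inj_on_if_independent_family:
  assumes "finite I" and indep: "\<And>c i. (\<Sum>i\<in>I. c i *s v i) = 0 \<Longrightarrow> i \<in> I \<Longrightarrow> c i = 0"
  shows "inj_on v I"
proof (rule inj_onI, rule ccontr)
  fix i j assume ij: "i \<in> I" "j \<in> I" "v i = v j" "i \<noteq> j"
  have unit: "(\<Sum>k\<in>I. of_bool (k = l) *s v k) = v l" if "l \<in> I" for l
  proof -
    have "of_bool (k = l) *s v k = (if k = l then v k else 0)" for k
      by simp
    then show ?thesis
      using that \<open>finite I\<close> by simp
  qed
  have "(\<Sum>k\<in>I. (of_bool (k = i) - of_bool (k = j)) *s v k) = 0"
    using ij by (simp add: scale_left_diff_distrib sum_subtractf unit)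
  then have "of_bool (i = i) - of_bool (i = j) = (0 :: 'a)"
    using ij(1) by (rule indep)
  then show False
    using ij(4) by simp
qed

lemma card_le_if_independent_family_in_span:
  assumes "finite I" "finite T" "v ` I \<subseteq> span T"
    and indep: "\<And>c i. (\<Sum>i\<in>I. c i *s v i) = 0 \<Longrightarrow> i \<in> I \<Longrightarrow> c i = 0"
  shows "card I \<le> card T"
proof -
  have inj: "inj_on v I"
    using \<open>finite I\<close> indep by (rule inj_on_if_independent_family)
  have "independent (v ` I)"
  proof (rule independent_if_scalars_zero)
    fix f x assume sum: "(\<Sum>x\<in>v ` I. f x *s x) = 0" and x: "x \<in> v ` I"
    have "(\<Sum>i\<in>I. f (v i) *s v i) = 0"
      using sum by (simp add: sum.reindex[OF inj])
    then show "f x = 0"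
      using x indep[of "f \<circ> v"] by auto
  qed (use \<open>finite I\<close> in simp)
  then have "card (v ` I) \<le> card T"
    using independent_span_bound[OF \<open>finite T\<close> _ assms(3)] by simp
  then show ?thesis
    by (simp add: card_image[OF inj])
qed

end

lemma sum_fun_apply:
  fixes f :: "'i \<Rightarrow> 'x \<Rightarrow> 'b::comm_monoid_add"
  shows "(\<Sum>i\<in>I. f i) x = (\<Sum>i\<in>I. f i x)"
  by (induction I rule: infinite_finite_induct) simp_all

interpretation fun_space: vector_space "\<lambda>(a :: 'k::field) (f :: 'x \<Rightarrow> 'k) x. a * f x"
  by unfold_locales (auto simp: fun_eq_iff algebra_simps)

definition function_rank_le :: "('x \<Rightarrow> 'k::field) set \<Rightarrow> nat \<Rightarrow> bool" where
  "function_rank_le V r \<longleftrightarrow> (\<exists>T. finite T \<and> card T \<le> r \<and> V \<subseteq> fun_space.span T)"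

lemma function_rank_le_span_Un:
  assumes "function_rank_le V r" "function_rank_le W r'" "Z \<subseteq> fun_space.span (V \<union> W)"
  shows "function_rank_le Z (r + r')"
proof -
  obtain S T where S: "finite S" "card S \<le> r" "V \<subseteq> fun_space.span S"
    and T: "finite T" "card T \<le> r'" "W \<subseteq> fun_space.span T"
    using assms(1,2) unfolding function_rank_le_def by blast
  have "V \<union> W \<subseteq> fun_space.span (S \<union> T)"
    using S(3) T(3) fun_space.span_mono[of S "S \<union> T"] fun_space.span_mono[of T "S \<union> T"] by auto
  then have "Z \<subseteq> fun_space.span (S \<union> T)"
    using assms(3) fun_space.span_minimal[OF _ fun_space.subspace_span] by blast
  moreover have "card (S \<union> T) \<le> r + r'"
    using card_Un_le[of S T] S(2) T(2) by linarith
  ultimately show ?thesis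
    using S(1) T(1) unfolding function_rank_le_def by (intro exI[of _ "S \<union> T"]) simp
qed

definition outcome_column ::
    "('z \<Rightarrow> 'k::field) \<Rightarrow> ('x, 'y, 'z) protocol \<Rightarrow> 'x set \<Rightarrow> 'y \<Rightarrow> 'x \<Rightarrow> 'k" where
  "outcome_column \<phi> P X y = (\<lambda>x. if x \<in> X then \<phi> (outcome P x y) else 0)"

lemma function_rank_le_outcome_columns_Alice:
  assumes "function_rank_le (outcome_column \<phi> P {x \<in> X. f x} ` Y) r"
    and "function_rank_le (outcome_column \<phi> Q {x \<in> X. \<not> f x} ` Y) r'"
  shows "function_rank_le (outcome_column \<phi> (Alice f P Q) X ` Y) (r + r')"
proof (rule function_rank_le_span_Un[OF assms], intro image_subsetI)
  let ?p = "outcome_column \<phi> P {x \<in> X. f x}" and ?q = "outcome_column \<phi> Q {x \<in> X. \<not> f x}"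
  fix y assume "y \<in> Y"
  have "outcome_column \<phi> (Alice f P Q) X y = ?p y + ?q y"
    by (auto simp: outcome_column_def fun_eq_iff)
  also have "\<dots> \<in> fun_space.span (?p ` Y \<union> ?q ` Y)"
    using \<open>y \<in> Y\<close> by (intro fun_space.span_add fun_space.span_base) auto
  finally show "outcome_column \<phi> (Alice f P Q) X y \<in> fun_space.span (?p ` Y \<union> ?q ` Y)" .
qed

lemma function_rank_le_outcome_columns_Bob:
  assumes "function_rank_le (outcome_column \<phi> P X ` {y \<in> Y. g y}) r"
    and "function_rank_le (outcome_column \<phi> Q X ` {y \<in> Y. \<not> g y}) r'"
  shows "function_rank_le (outcome_column \<phi> (Bob g P Q) X ` Y) (r + r')"
proof (rule function_rank_le_span_Un[OF assms], intro image_subsetI fun_space.span_base)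
  fix y assume "y \<in> Y"
  moreover have "outcome_column \<phi> (Bob g P Q) X y
      = (if g y then outcome_column \<phi> P X y else outcome_column \<phi> Q X y)"
    by (simp add: outcome_column_def fun_eq_iff)
  ultimately show "outcome_column \<phi> (Bob g P Q) X y
      \<in> outcome_column \<phi> P X ` {y \<in> Y. g y} \<union> outcome_column \<phi> Q X ` {y \<in> Y. \<not> g y}"
    by simp
qed

lemma function_rank_le_outcome_columns_empty:
  assumes "X = {} \<or> Y = {}"
  shows "function_rank_le (outcome_column \<phi> P X ` Y) r"
proof -
  have "outcome_column \<phi> P X ` Y \<subseteq> fun_space.span {}"
    using assms by (auto simp: outcome_column_def zero_fun_def)
  then show ?thesis
    unfolding function_rank_le_def by (intro exI[of _ "{}"]) simp
qed

lemma function_rank_le_outcome_columns_Output: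
  assumes "1 \<le> r"
  shows "function_rank_le (outcome_column \<phi> (Output z) X ` Y) r"
proof -
  let ?f = "\<lambda>x. if x \<in> X then \<phi> z else 0"
  have "outcome_column \<phi> (Output z) X ` Y \<subseteq> {?f}"
    by (auto simp: outcome_column_def)
  also have "\<dots> \<subseteq> fun_space.span {?f}"
    by (rule fun_space.span_superset)
  finally show ?thesis
    using assms unfolding function_rank_le_def by (intro exI[of _ "{?f}"]) simp
qed

lemma function_rank_le_outcome_columns:
  assumes "\<And>x y. x \<in> X \<Longrightarrow> y \<in> Y \<Longrightarrow> bits P x y \<le> d"
  shows "function_rank_le (outcome_column \<phi> P X ` Y) (2 ^ d)"
  using assms
proof (induction P arbitrary: X Y d)
  case (Output z)
  show ?case
    by (rule function_rank_le_outcome_columns_Output) simp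
next
  case (Alice f P Q)
  show ?case
  proof (cases d)
    case 0
    then show ?thesis
      using Alice.prems by (intro function_rank_le_outcome_columns_empty) fastforce
  next
    case (Suc e)
    have "function_rank_le (outcome_column \<phi> P {x \<in> X. f x} ` Y) (2 ^ e)"
      "function_rank_le (outcome_column \<phi> Q {x \<in> X. \<not> f x} ` Y) (2 ^ e)"
      using Alice.prems Suc by (fastforce intro!: Alice.IH)+
    then show ?thesis
      unfolding Suc power_Suc mult_2 by (rule function_rank_le_outcome_columns_Alice)
  qed
next
  case (Bob g P Q)
  show ?case
  proof (cases d)
    case 0
    then show ?thesis
      using Bob.prems by (intro function_rank_le_outcome_columns_empty) fastforce
  next
    case (Suc e)
    have "function_rank_le (outcome_column \<phi> P X ` {y \<in> Y. g y}) (2 ^ e)"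
      "function_rank_le (outcome_column \<phi> Q X ` {y \<in> Y. \<not> g y}) (2 ^ e)"
      using Bob.prems Suc by (fastforce intro!: Bob.IH)+
    then show ?thesis
      unfolding Suc power_Suc mult_2 by (rule function_rank_le_outcome_columns_Bob)
  qed
qed

lemma card_le_2_power_if_outcome_columns_independent:
  fixes \<phi> :: "'z \<Rightarrow> 'k::field"
  assumes "finite J"
    and bits: "\<And>i j. i \<in> I \<Longrightarrow> j \<in> J \<Longrightarrow> bits P (a i) (b j) \<le> d"
    and indep: "\<And>c j. (\<And>i. i \<in> I \<Longrightarrow> (\<Sum>j\<in>J. c j * \<phi> (outcome P (a i) (b j))) = 0) \<Longrightarrow> j \<in> J \<Longrightarrow> c j = 0"
  shows "card J \<le> 2 ^ d"
proof -
  let ?v = "\<lambda>j. outcome_column \<phi> P (a ` I) (b j)"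
  have "function_rank_le (?v ` J) (2 ^ d)"
    using function_rank_le_outcome_columns[of "a ` I" "b ` J" P d \<phi>] bits
    by (auto simp: image_image)
  then obtain T where T: "finite T" "card T \<le> 2 ^ d" "?v ` J \<subseteq> fun_space.span T"
    unfolding function_rank_le_def by blast
  have "card J \<le> card T"
  proof (rule fun_space.card_le_if_independent_family_in_span[OF \<open>finite J\<close> T(1,3)])
    fix c j assume zero: "(\<Sum>j\<in>J. (\<lambda>x. c j * ?v j x)) = 0" and "j \<in> J"
    have "(\<Sum>j\<in>J. c j * \<phi> (outcome P (a i) (b j))) = 0" if "i \<in> I" for i
      using fun_cong[OF zero, of "a i"] that by (simp add: sum_fun_apply outcome_column_def)
    then show "c j = 0"
      using \<open>j \<in> J\<close> by (rule indep)
  qed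
  then show ?thesis
    using T(2) by simp
qed

subsection \<open>Partition matroids\<close>

definition partition_indep :: "'i set \<Rightarrow> ('i \<Rightarrow> 'a set) \<Rightarrow> ('i \<Rightarrow> nat) \<Rightarrow> 'a set set" where
  "partition_indep I A cap = {T. T \<subseteq> (\<Union>i\<in>I. A i) \<and> (\<forall>i\<in>I. card (T \<inter> A i) \<le> cap i)}"

lemma card_eq_sum_Int_disjoint_family:
  assumes "finite I" "disjoint_family_on A I" "finite T" "T \<subseteq> (\<Union>i\<in>I. A i)"
  shows "card T = (\<Sum>i\<in>I. card (T \<inter> A i))"
proof -
  have "T = (\<Union>i\<in>I. T \<inter> A i)"
    using assms(4) by blast
  then have "card T = card (\<Union>i\<in>I. T \<inter> A i)"
    by simp
  also have "\<dots> = (\<Sum>i\<in>I. card (T \<inter> A i))"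
    using assms(1-3) by (intro card_UN_disjoint') (auto simp: disjoint_family_on_def)
  finally show ?thesis .
qed

lemma partition_indep_augmentation:
  assumes I: "finite I" "disjoint_family_on A I"
    and X: "X \<in> partition_indep I A cap" "finite X"
    and Y: "Y \<in> partition_indep I A cap" "finite Y" and "card X < card Y"
  shows "\<exists>e\<in>Y - X. insert e X \<in> partition_indep I A cap"
proof -
  have "(\<Sum>i\<in>I. card (X \<inter> A i)) < (\<Sum>i\<in>I. card (Y \<inter> A i))"
    using assms card_eq_sum_Int_disjoint_family[OF I] by (simp add: partition_indep_def)
  then obtain i where i: "i \<in> I" "card (X \<inter> A i) < card (Y \<inter> A i)"
    by (meson linorder_not_le sum_mono)
  then have "\<not> Y \<inter> A i \<subseteq> X \<inter> A i"
    using X(2) card_mono[of "X \<inter> A i" "Y \<inter> A i"] by auto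
  then obtain e where e: "e \<in> Y" "e \<notin> X" "e \<in> A i"
    by blast
  have "card (insert e X \<inter> A j) \<le> cap j" if "j \<in> I" for j
  proof (cases "j = i")
    case True
    have "card (insert e X \<inter> A i) \<le> card (Y \<inter> A i)"
      using e i(2) X(2) by simp
    then show ?thesis
      using Y(1) i(1) True by (auto simp: partition_indep_def)
  next
    case False
    then have "e \<notin> A j"
      using disjoint_family_onD[OF I(2) that i(1)] e(3) by blast
    then show ?thesis
      using X(1) that by (simp add: partition_indep_def)
  qed
  then have "insert e X \<in> partition_indep I A cap"
    using X(1) Y(1) e(1) by (auto simp: partition_indep_def)
  then show ?thesis
    using e by blast
qed

lemma matroid_partition_indep:
  assumes "finite U" "(\<Union>i\<in>I. A i) \<subseteq> U" "finite I" "disjoint_family_on A I"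
  shows "matroid U (partition_indep I A cap)"
proof
  have fin: "finite T" if "T \<in> partition_indep I A cap" for T
    using that assms(1,2) finite_subset[of T U] unfolding partition_indep_def by blast
  show "partition_indep I A cap \<subseteq> Pow U"
    using assms(2) by (auto simp: partition_indep_def)
  show "{} \<in> partition_indep I A cap"
    by (simp add: partition_indep_def)
  show "X \<in> partition_indep I A cap" if Y: "Y \<in> partition_indep I A cap" and "X \<subseteq> Y" for X Y
  proof -
    have "card (X \<inter> A i) \<le> card (Y \<inter> A i)" for i
      using fin[OF Y] \<open>X \<subseteq> Y\<close> by (intro card_mono) auto
    then show ?thesis
      using Y \<open>X \<subseteq> Y\<close> unfolding partition_indep_def by (blast intro: order_trans)
  qed
  show "\<exists>e\<in>Y - X. insert e X \<in> partition_indep I A cap"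
    if "X \<in> partition_indep I A cap" "Y \<in> partition_indep I A cap" "card X < card Y" for X Y
    using that fin partition_indep_augmentation[OF assms(3,4)] by blast
qed (use assms(1) in simp)

lemma card_Int_UN_le_sum_cap:
  assumes "T \<in> partition_indep I A cap" "finite J" "J \<subseteq> I"
  shows "card (T \<inter> (\<Union>j\<in>J. A j)) \<le> (\<Sum>j\<in>J. cap j)"
proof -
  have "card (T \<inter> (\<Union>j\<in>J. A j)) \<le> (\<Sum>j\<in>J. card (T \<inter> A j))"
    using card_UN_le[OF assms(2), of "\<lambda>j. T \<inter> A j"] by (simp only: Int_UN_distrib)
  also have "\<dots> \<le> (\<Sum>j\<in>J. cap j)"
    using assms(1,3) by (intro sum_mono) (auto simp: partition_indep_def)
  finally show ?thesis .
qed

subsection \<open>Connectivity as matroid intersection\<close>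

lemma Union_blocks_subset:
  assumes "partition_on V P" "K \<subseteq> V" "same_block P `` K \<subseteq> K"
  shows "\<Union>{C \<in> P. C \<subseteq> K} = K"
proof (intro equalityI subsetI)
  fix x assume "x \<in> K"
  then obtain C where "C \<in> P" "x \<in> C"
    using assms(2) partition_onD1[OF assms(1)] by blast
  moreover from this have "C \<subseteq> K"
    using assms(3) \<open>x \<in> K\<close> by (auto simp: same_block_def)
  ultimately show "x \<in> \<Union>{C \<in> P. C \<subseteq> K}"
    by blast
qed auto

lemma rtrancl_imp_chordless_walk:
  assumes "(s, t) \<in> R\<^sup>*"
  shows "\<exists>f n. f 0 = s \<and> f n = t \<and> (\<forall>i<n. (f i, f (Suc i)) \<in> R) \<and>
    (\<forall>j<n. \<forall>i<j. (f i, f (Suc j)) \<notin> R)"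
proof -
  define n where "n = (LEAST k. (s, t) \<in> R ^^ k)"
  have "(s, t) \<in> R ^^ n"
    unfolding n_def using rtrancl_imp_relpow[OF assms] by (rule LeastI_ex)
  then obtain f where f: "f 0 = s" "f n = t" "\<forall>i<n. (f i, f (Suc i)) \<in> R"
    unfolding relpow_fun_conv by blast
  have walk: "(f i, f j) \<in> R ^^ (j - i)" if "i \<le> j" "j \<le> n" for i j
    unfolding relpow_fun_conv using that f(3) by (intro exI[of _ "\<lambda>k. f (i + k)"]) auto
  have "(f i, f (Suc j)) \<notin> R" if "j < n" "i < j" for i j
  proof
    assume "(f i, f (Suc j)) \<in> R"
    then have "(f i, f n) \<in> R ^^ Suc (n - Suc j)"
      using walk[of "Suc j" n] \<open>j < n\<close> by (intro relpow_Suc_I2) auto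
    then have "(s, t) \<in> R ^^ (i + Suc (n - Suc j))"
      using walk[of 0 i] that f(1,2) unfolding relpow_add by auto
    moreover have "i + Suc (n - Suc j) < n"
      using that by linarith
    ultimately show False
      unfolding n_def using not_less_Least by blast
  qed
  then show ?thesis
    using f by blast
qed

lemma card_image_Int_eq_sum_of_bool:
  assumes "finite I" "inj_on f I"
  shows "card (f ` I \<inter> C) = (\<Sum>i\<in>I. of_bool (f i \<in> C))"
proof -
  have "f ` I \<inter> C = f ` (I \<inter> {i. f i \<in> C})"
    by blast
  moreover have "inj_on f (I \<inter> {i. f i \<in> C})"
    using assms(2) by (rule inj_on_subset) auto
  ultimately show ?thesis
    using assms(1) by (simp add: card_image)
qed

lemma join_rel_imp_alternating_walk:
  assumes P: "partition_on V P" and Q: "partition_on V Q" and st: "(s, t) \<in> join_rel P Q"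
  shows "\<exists>f g n. f 0 = s \<and> f n = t \<and> inj_on f {..<n} \<and> inj_on g {..<n} \<and>
    (\<forall>i<n. (f i, g i) \<in> same_block P \<and> (g i, f (Suc i)) \<in> same_block Q)"
proof -
  let ?R = "same_block P O same_block Q"
  have "same_block P \<union> same_block Q \<subseteq> ?R"
    using equiv_same_block[OF P] equiv_same_block[OF Q] unfolding equiv_def refl_on_def by blast
  then have "(s, t) \<in> ?R\<^sup>*"
    using st unfolding join_rel_def by (meson rtrancl_mono subsetD trancl_into_rtrancl)
  then obtain f n where f: "f 0 = s" "f n = t" "\<forall>i<n. (f i, f (Suc i)) \<in> ?R"
    and chordless: "\<forall>j<n. \<forall>i<j. (f i, f (Suc j)) \<notin> ?R"
    using rtrancl_imp_chordless_walk[of s t ?R] by blast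
  from f(3) have "\<forall>i<n. \<exists>y. (f i, y) \<in> same_block P \<and> (y, f (Suc i)) \<in> same_block Q"
    by blast
  then obtain g where g: "\<forall>i<n. (f i, g i) \<in> same_block P \<and> (g i, f (Suc i)) \<in> same_block Q"
    by metis
  have "f i \<noteq> f j" "g i \<noteq> g j" if "i < j" "j < n" for i j
    using chordless that f(3) g by (metis order.strict_trans relcomp.relcompI)+
  then have "inj_on f {..<n}" "inj_on g {..<n}"
    by (auto intro!: linorder_inj_onI)
  with f(1,2) g show ?thesis
    by blast
qed

text \<open>The flow is the difference of the indicator functions of \<open>X\<close> and \<open>Y\<close>.\<close>

lemma connected_imp_unit_flow:
  assumes P: "partition_on V P" and Q: "partition_on V Q" and st: "(s, t) \<in> join_rel P Q"
  shows "\<exists>X Y. X \<subseteq> V \<and> Y \<subseteq> V \<and> card X = card Y \<and>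
    (\<forall>C\<in>P. card (X \<inter> C) = card (Y \<inter> C)) \<and>
    (\<forall>D\<in>Q. card (X \<inter> D) + of_bool (s \<in> D) = card (Y \<inter> D) + of_bool (t \<in> D))"
proof -
  obtain f g n where f: "f 0 = s" "f n = t" and inj: "inj_on f {..<n}" "inj_on g {..<n}"
    and walk: "\<forall>i<n. (f i, g i) \<in> same_block P \<and> (g i, f (Suc i)) \<in> same_block Q"
    using join_rel_imp_alternating_walk[OF P Q st] by blast
  note card_Int = inj[THEN card_image_Int_eq_sum_of_bool[OF finite_lessThan]]
  have "card (g ` {..<n} \<inter> C) = card (f ` {..<n} \<inter> C)" if "C \<in> P" for C
    unfolding card_Int using walk same_block_cong[OF P that] by (intro sum.cong) auto
  moreover have "card (g ` {..<n} \<inter> D) + of_bool (s \<in> D) = card (f ` {..<n} \<inter> D) + of_bool (t \<in> D)"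
    if "D \<in> Q" for D
  proof -
    have "(\<Sum>i<n. of_bool (g i \<in> D)) = (\<Sum>i<n. of_bool (f (Suc i) \<in> D) :: nat)"
      using walk same_block_cong[OF Q that] by (intro sum.cong) auto
    moreover have "of_bool (f 0 \<in> D) + (\<Sum>i<n. of_bool (f (Suc i) \<in> D) :: nat)
        = (\<Sum>i<n. of_bool (f i \<in> D)) + of_bool (f n \<in> D)"
      using sum.lessThan_Suc_shift[of "\<lambda>i. of_bool (f i \<in> D) :: nat" n]
        sum.lessThan_Suc[of "\<lambda>i. of_bool (f i \<in> D) :: nat" n] by linarith
    ultimately show ?thesis
      unfolding card_Int f by linarith
  qed
  moreover have "f ` {..<n} \<subseteq> V" "g ` {..<n} \<subseteq> V"
    using walk partition_onD1[OF P] by (auto simp: same_block_def)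
  moreover have "card (g ` {..<n}) = card (f ` {..<n})"
    using inj by (simp add: card_image)
  ultimately show ?thesis
    by (intro exI[of _ "g ` {..<n}"] exI[of _ "f ` {..<n}"] conjI ballI) simp_all
qed

locale point_copies =
  fixes V :: "'v set" and U :: "'a set" and copy :: "'v \<times> bool \<Rightarrow> 'a"
  assumes finite_V: "finite V" and finite_U: "finite U"
    and inj_on_copy: "inj_on copy (V \<times> UNIV)" and copy_image: "copy ` (V \<times> UNIV) \<subseteq> U"
begin

definition copies :: "'v set \<Rightarrow> 'a set" where
  "copies C = copy ` (C \<times> UNIV)"

text \<open>
  Alice uses \<open>\<sigma> = id\<close>, so the capacity of a block is its size.  Bob uses \<open>\<sigma> = id(s := t)\<close>,
  which moves one unit of capacity from the block of \<open>s\<close> to that of \<open>t\<close>.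
\<close>

definition block_indep :: "'v set set \<Rightarrow> ('v \<Rightarrow> 'v) \<Rightarrow> 'a set set" where
  "block_indep P \<sigma> = partition_indep P copies (\<lambda>C. card {x \<in> V. \<sigma> x \<in> C})"

lemma copies_Union: "copies (\<Union>L) = (\<Union>C\<in>L. copies C)"
  by (auto simp: copies_def)

lemma UN_copies_blocks: "partition_on V P \<Longrightarrow> (\<Union>C\<in>P. copies C) = copies V"
  by (simp add: partition_on_def flip: copies_Union)

lemma matroid_block_indep:
  assumes P: "partition_on V P"
  shows "matroid U (block_indep P \<sigma>)"
  unfolding block_indep_def
proof (rule matroid_partition_indep)
  show "(\<Union>C\<in>P. copies C) \<subseteq> U"
    unfolding UN_copies_blocks[OF P] using copy_image by (simp add: copies_def)
  have "copies C \<inter> copies D = {}" if "C \<in> P" "D \<in> P" "C \<noteq> D" for C D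
  proof -
    have "C \<inter> D = {}"
      using partition_onD2[OF P] that by (rule disjointD)
    moreover have "C \<subseteq> V" "D \<subseteq> V"
      using that partition_onD1[OF P] by auto
    ultimately show ?thesis
      using inj_on_image_Int[OF inj_on_copy, of "C \<times> UNIV" "D \<times> UNIV"]
      by (auto simp: copies_def simp flip: Times_Int_distrib1)
  qed
  then show "disjoint_family_on copies P"
    by (simp add: disjoint_family_on_def)
qed (use finite_U finite_elements[OF finite_V P] in simp_all)

lemma card_Int_copies_le:
  assumes P: "partition_on V P" and T: "T \<in> block_indep P \<sigma>"
    and K: "K \<subseteq> V" "same_block P `` K \<subseteq> K"
  shows "card (T \<inter> copies K) \<le> card {x \<in> V. \<sigma> x \<in> K}"
proof -
  let ?L = "{C \<in> P. C \<subseteq> K}"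
  have L: "\<Union>?L = K" "finite ?L"
    using Union_blocks_subset[OF P K] finite_elements[OF finite_V P] by simp_all
  have "card (T \<inter> copies (\<Union>?L)) \<le> (\<Sum>C\<in>?L. card {x \<in> V. \<sigma> x \<in> C})"
    unfolding copies_Union using T L(2)
    by (intro card_Int_UN_le_sum_cap) (auto simp: block_indep_def)
  also have "\<dots> = card (\<Union>C\<in>?L. {x \<in> V. \<sigma> x \<in> C})"
    using L(2) finite_V partition_on_block_unique[OF P]
    by (intro card_UN_disjoint'[symmetric]) (auto simp: disjoint_family_on_def)
  also have "(\<Union>C\<in>?L. {x \<in> V. \<sigma> x \<in> C}) = {x \<in> V. \<sigma> x \<in> \<Union>?L}"
    by blast
  finally show ?thesis
    unfolding L(1) .
qed

lemma block_indep_subset: "partition_on V P \<Longrightarrow> T \<in> block_indep P \<sigma> \<Longrightarrow> T \<subseteq> copies V"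
  by (simp add: block_indep_def partition_indep_def UN_copies_blocks)

lemma card_block_indep_id_le:
  assumes P: "partition_on V P" and T: "T \<in> block_indep P id"
  shows "card T \<le> card V"
proof -
  have "same_block P `` V \<subseteq> V"
    using partition_onD1[OF P] by (auto simp: same_block_def)
  then have "card (T \<inter> copies V) \<le> card {x \<in> V. id x \<in> V}"
    by (rule card_Int_copies_le[OF P T subset_refl])
  then show ?thesis
    using block_indep_subset[OF P T] by (simp add: Int_absorb2)
qed

lemma disconnected_imp_card_common_indep_less:
  assumes st: "s \<in> V" "(s, t) \<notin> join_rel P Q" and P: "partition_on V P" and Q: "partition_on V Q"
    and T: "T \<in> block_indep P id" "T \<in> block_indep Q (id(s := t))"
  shows "card T < card V"
proof -
  define K where "K = join_rel P Q `` {s}"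
  have join: "equiv V (join_rel P Q)"
    using P Q by (rule equiv_join_rel)
  then have K: "K \<subseteq> V" "s \<in> K" "t \<notin> K"
    using st by (auto simp: K_def elim!: equivE dest: refl_onD)
  have closed: "x \<in> K \<longleftrightarrow> y \<in> K" if "(x, y) \<in> join_rel P Q" for x y
    using join that unfolding K_def by (metis Image_singleton_iff equivE symD transD)
  have "same_block Q `` K \<subseteq> K" "same_block P `` (V - K) \<subseteq> V - K"
    using closed same_block_Un_subset_join_rel[of P Q] equiv_same_block[OF P]
    by (auto elim!: equivE)
  then have "card (T \<inter> copies K) \<le> card {x \<in> V. (id(s := t)) x \<in> K}"
      "card (T \<inter> copies (V - K)) \<le> card {x \<in> V. id x \<in> V - K}"
    using K(1) T P Q by (intro card_Int_copies_le; blast)+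
  moreover have "{x \<in> V. (id(s := t)) x \<in> K} = K - {s}" "{x \<in> V. id x \<in> V - K} = V - K"
    using K by auto
  moreover have "T = T \<inter> copies K \<union> T \<inter> copies (V - K)"
    using block_indep_subset[OF P T(1)] by (auto simp: copies_def)
  then have "card T \<le> card (T \<inter> copies K) + card (T \<inter> copies (V - K))"
    by (metis card_Un_le)
  moreover have "card (K - {s}) < card K"
    using K finite_V by (meson card_Diff1_less finite_subset)
  moreover have "card K + card (V - K) = card V"
    using K(1) finite_V by (metis card_Diff_subset card_mono finite_subset le_add_diff_inverse)
  ultimately show ?thesis
    by simp
qed

lemma card_copy_image_Int_copies:
  assumes "X \<subseteq> V" "Y \<subseteq> V" "C \<subseteq> V"
  shows "card (copy ` ((V - Y) \<times> {False} \<union> X \<times> {True}) \<inter> copies C) + card (Y \<inter> C)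
    = card C + card (X \<inter> C)"
proof -
  have "copy ` ((V - Y) \<times> {False} \<union> X \<times> {True}) \<inter> copies C
      = copy ` (((V - Y) \<times> {False} \<union> X \<times> {True}) \<inter> (C \<times> UNIV))"
    using assms unfolding copies_def by (intro inj_on_image_Int[OF inj_on_copy, symmetric]) auto
  also have "((V - Y) \<times> {False} \<union> X \<times> {True}) \<inter> (C \<times> UNIV)
      = (C - Y) \<times> {False} \<union> (X \<inter> C) \<times> {True}"
    using assms(3) by auto
  also have "card (copy ` \<dots>) = card ((C - Y) \<times> {False} \<union> (X \<inter> C) \<times> {True})"
    using assms by (intro card_image inj_on_subset[OF inj_on_copy]) auto
  also have "\<dots> = card (C - Y) + card (X \<inter> C)"
    using assms finite_V
    by (subst card_Un_disjoint) (auto simp: finite_subset card_cartesian_product)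
  finally show ?thesis
    using assms(3) finite_V card_Int_Diff[of C Y] by (simp add: finite_subset Int_commute)
qed

lemma card_redirected_preimage:
  assumes "s \<in> V" "D \<subseteq> V"
  shows "card {x \<in> V. (id(s := t)) x \<in> D} + of_bool (s \<in> D) = card D + of_bool (t \<in> D)"
proof -
  have "{x \<in> V. (id(s := t)) x \<in> D} = (if t \<in> D then insert s (D - {s}) else D - {s})"
    using assms by auto
  moreover have "finite D"
    using assms(2) finite_V finite_subset by blast
  then have "card (D - {s}) + of_bool (s \<in> D) = card D"
    using card_Suc_Diff1[of D s] by (cases "s \<in> D") auto
  ultimately show ?thesis
    using \<open>finite D\<close> by (cases "t \<in> D") (auto simp del: insert_Diff_single)
qed

lemma connected_imp_common_indep:
  assumes P: "partition_on V P" and Q: "partition_on V Q" and st: "(s, t) \<in> join_rel P Q"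
  shows "\<exists>T \<in> block_indep P id \<inter> block_indep Q (id(s := t)). card T = card V"
proof -
  obtain X Y where XY: "X \<subseteq> V" "Y \<subseteq> V" "card X = card Y"
    and X_eq_Y: "\<forall>C\<in>P. card (X \<inter> C) = card (Y \<inter> C)"
    and flow: "\<forall>D\<in>Q. card (X \<inter> D) + of_bool (s \<in> D) = card (Y \<inter> D) + of_bool (t \<in> D)"
    using connected_imp_unit_flow[OF P Q st] by blast
  define T where "T = copy ` ((V - Y) \<times> {False} \<union> X \<times> {True})"
  have T_sub: "T \<subseteq> copies V"
    using XY by (auto simp: T_def copies_def)
  have card_T: "card (T \<inter> copies C) + card (Y \<inter> C) = card C + card (X \<inter> C)" if "C \<subseteq> V" for C
    unfolding T_def using XY(1,2) that by (rule card_copy_image_Int_copies)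
  have blocks: "C \<subseteq> V" if "C \<in> P \<union> Q" for C
    using that partition_onD1[OF P] partition_onD1[OF Q] by auto
  have "s \<in> V"
    using st equiv_join_rel[OF P Q] by (auto elim!: equivE)
  have "card (T \<inter> copies C) \<le> card {x \<in> V. id x \<in> C}" if "C \<in> P" for C
  proof -
    have "{x \<in> V. id x \<in> C} = C"
      using blocks that by auto
    then show ?thesis
      using card_T[of C] X_eq_Y blocks that by simp
  qed
  moreover have "card (T \<inter> copies D) \<le> card {x \<in> V. (id(s := t)) x \<in> D}" if "D \<in> Q" for D
    using card_T[of D] flow card_redirected_preimage[OF \<open>s \<in> V\<close>, of D t] blocks that by fastforce
  ultimately have "T \<in> block_indep P id \<inter> block_indep Q (id(s := t))"
    using T_sub by (simp add: block_indep_def partition_indep_def UN_copies_blocks P Q)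
  moreover have "card T = card V"
    using card_T[of V] T_sub XY by (simp add: Int_absorb2)
  ultimately show ?thesis
    by blast
qed

lemma card_max_common_indep_eq_iff:
  assumes s: "s \<in> V" and P: "partition_on V P" and Q: "partition_on V Q"
    and max: "is_arg_max card (\<lambda>T. T \<in> block_indep P id \<inter> block_indep Q (id(s := t))) T"
  shows "card T = card V \<longleftrightarrow> (s, t) \<in> join_rel P Q"
proof
  have T: "T \<in> block_indep P id" "T \<in> block_indep Q (id(s := t))"
    using max by (simp_all add: is_arg_max_def)
  show "(s, t) \<in> join_rel P Q" if "card T = card V"
    using disconnected_imp_card_common_indep_less[OF s _ P Q T] that by fastforce
  show "card T = card V" if "(s, t) \<in> join_rel P Q"
  proof (rule antisym)
    show "card T \<le> card V"
      using P T(1) by (rule card_block_indep_id_le)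
    show "card V \<le> card T"
      using connected_imp_common_indep[OF P Q that] max by (metis is_arg_max_linorder)
  qed
qed

lemma card_outcome_eq_iff:
  assumes "s \<in> V" and P: "partition_on V P" and Q: "partition_on V Q"
    and "solves_matroid_intersection U prot"
  shows "card (outcome prot (block_indep P id) (block_indep Q (id(s := t)))) = card V
    \<longleftrightarrow> (s, t) \<in> join_rel P Q"
  using assms matroid_block_indep[OF P] matroid_block_indep[OF Q]
  unfolding solves_matroid_intersection_def by (intro card_max_common_indep_eq_iff) blast+

end

subsection \<open>The lower bound\<close>

lemma separation_matrix_nonsingular:
  assumes A: "finite A" "s \<in> A" "t \<in> A"
    and rel: "\<And>P. P \<in> separating_partitions A s t \<Longrightarrow>
      (\<Sum>Q\<in>separating_partitions A s t. c Q * of_bool ((s, t) \<notin> join_rel P Q)) = (0::real)"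
    and Q: "Q \<in> separating_partitions A s t"
  shows "c Q = 0"
proof -
  let ?S = "separating_partitions A s t"
  have part: "partition_on A P" if "P \<in> ?S" for P
    using that by (simp add: separating_partitions_def)
  have "reflp_on ?S (refines A)"
    by (intro reflp_onI refines_refl part)
  moreover have "antisymp_on ?S (refines A)"
    by (rule antisymp_onI) (rule refines_asym)
  moreover have "transp_on ?S (refines A)"
    by (rule transp_onI) (rule refines_trans)
  moreover have "(\<Sum>Q\<in>?S. c Q *
      (\<Sum>Z | Z \<in> ?S \<and> refines A P Z \<and> refines A Q Z. separation_weight Z)) = 0"
    if "P \<in> ?S" for P
    using rel[OF that] separation_eq_sum_separation_weight[OF A part part] that by simp
  ultimately show ?thesis
    using weighted_upper_bound_sums_nonsingular[OF finite_separating_partitions[OF A(1)]]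
      separation_weight_nonzero Q by blast
qed

lemma bits_le_communication_cost:
  assumes "finite U" "matroid U I1" "matroid U I2"
  shows "bits P I1 I2 \<le> communication_cost U P"
proof -
  have "{bits P I1 I2 | I1 I2. matroid U I1 \<and> matroid U I2}
      \<subseteq> (\<lambda>(I1, I2). bits P I1 I2) ` (Pow (Pow U) \<times> Pow (Pow U))"
    using matroid.indep_subset by fastforce
  then have "finite {bits P I1 I2 | I1 I2. matroid U I1 \<and> matroid U I2}"
    by (rule finite_subset) (use assms(1) in simp)
  then show ?thesis
    unfolding communication_cost_def using assms by (intro Max_ge) blast+
qed

lemma card_separating_partitions_le:
  fixes V :: "'v set" and U :: "'a set"
  assumes U: "finite U" and V: "finite V" "2 * card V \<le> card U" "s \<in> V" "t \<in> V"
    and sol: "solves_matroid_intersection U prot"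
  shows "card (separating_partitions V s t) \<le> 2 ^ communication_cost U prot"
proof -
  have "card (V \<times> (UNIV :: bool set)) \<le> card U"
    using V(2) by (simp add: card_cartesian_product)
  then obtain copy where "copy ` (V \<times> (UNIV :: bool set)) \<subseteq> U"
      "inj_on copy (V \<times> (UNIV :: bool set))"
    using card_le_inj[of "V \<times> (UNIV :: bool set)" U] U V(1) by auto
  then interpret point_copies V U copy
    using U V(1) by unfold_locales
  let ?S = "separating_partitions V s t"
  let ?A = "\<lambda>P. block_indep P id" and ?B = "\<lambda>Q. block_indep Q (id(s := t))"
  define \<phi> :: "'a set \<Rightarrow> real" where "\<phi> T = of_bool (card T \<noteq> card V)" for T
  have part: "partition_on V P" if "P \<in> ?S" for P
    using that by (simp add: separating_partitions_def)
  have \<phi>: "\<phi> (outcome prot (?A P) (?B Q)) = of_bool ((s, t) \<notin> join_rel P Q)"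
    if "P \<in> ?S" "Q \<in> ?S" for P Q
    unfolding \<phi>_def using card_outcome_eq_iff[OF V(3) part part sol] that by simp
  show ?thesis
  proof (rule card_le_2_power_if_outcome_columns_independent)
    show "finite ?S"
      using V(1) by (rule finite_separating_partitions)
    show "bits prot (?A P) (?B Q) \<le> communication_cost U prot" if "P \<in> ?S" "Q \<in> ?S" for P Q
      using U part that by (intro bits_le_communication_cost matroid_block_indep) auto
    show "c Q = 0"
      if "\<And>P. P \<in> ?S \<Longrightarrow> (\<Sum>Q\<in>?S. c Q * \<phi> (outcome prot (?A P) (?B Q))) = 0" "Q \<in> ?S" for c Q
      using that \<phi> by (intro separation_matrix_nonsingular[OF V(1,3,4), of c Q]) simp_all
  qed
qed

lemma card_power_le_card_separating_partitions:
  assumes fin: "finite A" "finite B" and "A \<inter> B = {}" "s \<in> B" "t \<in> B" "s \<noteq> t"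
  shows "card B ^ card A \<le> card (separating_partitions (A \<union> B) s t)"
proof -
  define F where "F h = (\<lambda>b. insert b {a \<in> A. h a = b}) ` B" for h
  have mem: "(a, b) \<in> same_block (F h) \<longleftrightarrow> h a = b" if "a \<in> A" "b \<in> B" for h a b
    using that assms(3) by (auto simp: F_def same_block_def)
  have "F h \<in> separating_partitions (A \<union> B) s t" if h: "h \<in> A \<rightarrow>\<^sub>E B" for h
  proof -
    have "partition_on (A \<union> B) (F h)"
    proof (rule partition_onI)
      show "\<Union>(F h) = A \<union> B"
        using h by (auto simp: F_def)
      show "disjnt p q" if "p \<in> F h" "q \<in> F h" "p \<noteq> q" for p q
        using that assms(3) by (auto simp: F_def disjnt_iff)
    qed (auto simp: F_def)
    moreover have "(s, t) \<notin> same_block (F h)"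
      using assms(3-6) by (auto simp: F_def same_block_def)
    ultimately show ?thesis
      by (simp add: separating_partitions_def)
  qed
  moreover have "inj_on F (A \<rightarrow>\<^sub>E B)"
  proof (rule inj_onI)
    fix g h assume g: "g \<in> A \<rightarrow>\<^sub>E B" and h: "h \<in> A \<rightarrow>\<^sub>E B" and eq: "F g = F h"
    show "g = h"
    proof (rule PiE_ext[OF g h])
      fix a assume "a \<in> A"
      then have "g a \<in> B"
        using g by auto
      with \<open>a \<in> A\<close> show "g a = h a"
        using mem[of a "g a" g] mem[of a "g a" h] by (simp add: eq)
    qed
  qed
  ultimately have "card (A \<rightarrow>\<^sub>E B) \<le> card (separating_partitions (A \<union> B) s t)"
    using fin by (intro card_inj_on_le[of F]) (auto simp: finite_separating_partitions)
  then show ?thesis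
    using fin(1) by (simp add: card_PiE)
qed

lemma power_self_le_2_power_communication_cost:
  fixes U :: "'a set"
  assumes "finite U" "2 \<le> k" "4 * k \<le> card U" "solves_matroid_intersection U prot"
  shows "k ^ k \<le> 2 ^ communication_cost U prot"
proof -
  have "{k..<2 * k} \<inter> {..<k} = {}"
    by auto
  then have "k ^ k \<le> card (separating_partitions ({k..<2 * k} \<union> {..<k}) 0 1)"
    using card_power_le_card_separating_partitions[of "{k..<2 * k}" "{..<k}" 0 1] assms(2) by simp
  also have "{k..<2 * k} \<union> {..<k} = {..<2 * k}"
    by auto
  also have "card (separating_partitions {..<2 * k} 0 1) \<le> 2 ^ communication_cost U prot"
    using assms by (intro card_separating_partitions_le) auto
  finally show ?thesis .
qed

lemma mult_log_div_4_ge: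
  fixes n :: nat
  assumes "64 \<le> n"
  shows "1/16 * (n * log 2 n) \<le> (n div 4) * log 2 (n div 4)"
proof -
  have k: "n / 8 \<le> n div 4"
    using assms by linarith
  have "8 \<le> sqrt n"
    using assms by (intro real_le_rsqrt) simp
  then have "8 * sqrt n \<le> sqrt n * sqrt n"
    by (intro mult_right_mono) auto
  then have "sqrt n \<le> n div 4"
    using k by simp
  then have "log 2 (sqrt n) \<le> log 2 (n div 4)"
    using assms by (subst log_le_cancel_iff) auto
  then have "log 2 n / 2 \<le> log 2 (n div 4)"
    by (simp add: log_def ln_sqrt)
  then have "n / 8 * (log 2 n / 2) \<le> (n div 4) * log 2 (n div 4)"
    using k assms by (intro mult_mono) auto
  then show ?thesis
    by simp
qed

theorem theorem8p1:
  "\<exists>c::real. c > 0 \<and> (\<exists>N::nat. \<forall>n\<ge>N. \<forall>U::'a set. finite U \<and> card U = n \<longrightarrow>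
     (\<forall>P. solves_matroid_intersection U P \<longrightarrow>
        c * (real n * log 2 (real n)) \<le> real (communication_cost U P)))"
proof (intro exI[of _ "1/16"] conjI exI[of _ 64] allI impI)
  fix n :: nat and U :: "'a set" and P :: "'a matroid_protocol"
  assume n: "64 \<le> n" and U: "finite U \<and> card U = n" and P: "solves_matroid_intersection U P"
  define k where "k = n div 4"
  have "2 \<le> k" "4 * k \<le> card U"
    using n U by (auto simp: k_def)
  then have "k ^ k \<le> 2 ^ communication_cost U P"
    using U P by (intro power_self_le_2_power_communication_cost) auto
  then have "log 2 (k ^ k) \<le> communication_cost U P"
    using \<open>2 \<le> k\<close> by (intro log2_of_power_le) auto
  then have "k * log 2 k \<le> communication_cost U P"
    using \<open>2 \<le> k\<close> by (simp add: log_nat_power)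
  with mult_log_div_4_ge[OF n]
  show "1/16 * (real n * log 2 (real n)) \<le> real (communication_cost U P)"
    unfolding k_def by linarith
qed simp

end
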